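(* Let $G'$ be a connected locally cubical graph and let $G'\square_\sigma H_r$ ($r\ge1$) be an $H_r$-bundle over $G'$. Then $G'\square_\sigma H_r$ satisfies $\mathrm{CD}(2,\infty)$ if and only if $G'\square_\sigma H_r$ is itself locally cubical.
   Context: Graphs are simple, unweighted and locally finite. For a function $f$ on the vertices put $Lf(x)=\sum_{y\sim x}(f(y)-f(x))$. The Bakry--Émery operators are $2\Gamma(f,g)=L(fg)-fLg-gLf$ and $2\Gamma_2(f,g)=L\Gamma(f,g)-\Gamma(f,Lg)-\Gamma(g,Lf)$, with $\Gamma(f)=\Gamma(f,f)$ and $\Gamma_2(f)=\Gamma_2(f,f)$. A graph satisfies $\mathrm{CD}(K,\infty)$ if $\Gamma_2(f)(x)\ge K\,\Gamma(f)(x)$ for all real functions $f$ on the vertices and all vertices $x$. $S_k(x)$ denotes the set of vertices at distance exactly $k$ from $x$. Exact square incidence: for a vertex $x$ and distinct $y,z\in S_1(x)$, the triple $(x;y,z)$ satisfies exact square incidence if (a) $y\not\sim z$; (b) there is a unique $w\in S_2(x)$ with $w\sim y$ and $w\sim z$; (c) this $w$ satisfies $S_1(x)\cap S_1(w)=\{y,z\}$. A graph is locally cubical if for every vertex $x$ and any two distinct $y,z\in S_1(x)$ the triple $(x;y,z)$ satisfies exact square incidence. $H_r$ is the $r$-dimensional hypercube: vertex set $\mathbb{F}_2^r$, two vertices adjacent iff they differ in exactly one coordinate. Graph bundles: given graphs $G',F$ and a map $\sigma$ assigning to each oriented edge $(x,y)$ of $G'$ an automorphism $\sigma_{xy}\in\operatorname{Aut}(F)$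 with $\sigma_{yx}=\sigma_{xy}^{-1}$, the $F$-bundle $G'\square_\sigma F$ over $G'$ has vertex set $V(G')\times V(F)$ and edges $(x,u)\sim(y,\sigma_{xy}(u))$ whenever $x\sim y$ in $G'$, and $(x,u)\sim(x,v)$ whenever $u\sim v$ in $F$. *)

theory Defs
  imports Complex_Main "HOL-Library.Z2" "HOL-Library.Extended_Nat"
begin

record 'a graph =
  verts :: "'a set"
  adj :: "'a \<Rightarrow> 'a \<Rightarrow> bool"

definition simple_graph :: "'a graph \<Rightarrow> bool" where
  "simple_graph G \<longleftrightarrow>
     (\<forall>x y. adj G x y \<longrightarrow> x \<in> verts G \<and> y \<in> verts G) \<and>
     (\<forall>x y. adj G x y \<longrightarrow> adj G y x) \<and>
     (\<forall>x. \<not> adj G x x)"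

definition locally_finite :: "'a graph \<Rightarrow> bool" where
  "locally_finite G \<longleftrightarrow> (\<forall>x\<in>verts G. finite {y. adj G x y})"

definition connected_graph :: "'a graph \<Rightarrow> bool" where
  "connected_graph G \<longleftrightarrow> (\<forall>x\<in>verts G. \<forall>y\<in>verts G. (adj G)\<^sup>*\<^sup>* x y)"

text \<open>
  Functions on the vertices are functions on the whole carrier type.  In a simple graph, none of
  the operators below reads a value outside \<open>verts G\<close> at a vertex of \<open>G\<close>.  The sum is the intended
  one only if the graph is locally finite.
\<close>

definition laplacian :: "'a graph \<Rightarrow> ('a \<Rightarrow> real) \<Rightarrow> 'a \<Rightarrow> real" where
  "laplacian G f x = (\<Sum>y | adj G x y. f y - f x)"

definition Gam :: "'a graph \<Rightarrow> ('a \<Rightarrow> real) \<Rightarrow> ('a \<Rightarrow> real) \<Rightarrow> 'a \<Rightarrow> real" where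
  "Gam G f g x =
     (laplacian G (\<lambda>y. f y * g y) x - f x * laplacian G g x - g x * laplacian G f x) / 2"

definition Gam2 :: "'a graph \<Rightarrow> ('a \<Rightarrow> real) \<Rightarrow> ('a \<Rightarrow> real) \<Rightarrow> 'a \<Rightarrow> real" where
  "Gam2 G f g x =
     (laplacian G (Gam G f g) x - Gam G f (laplacian G g) x - Gam G g (laplacian G f) x) / 2"

text \<open>The curvature-dimension condition \<open>CD(K,\<infinity>)\<close>.\<close>

definition CD_inf :: "'a graph \<Rightarrow> real \<Rightarrow> bool" where
  "CD_inf G K \<longleftrightarrow> (\<forall>f. \<forall>x\<in>verts G. Gam2 G f f x \<ge> K * Gam G f f x)"

text \<open>Combinatorial distance: least length of a walk, \<open>\<infinity>\<close> if there is none.\<close>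

definition graph_dist :: "'a graph \<Rightarrow> 'a \<Rightarrow> 'a \<Rightarrow> enat" where
  "graph_dist G x y = (INF k \<in> {k. (adj G ^^ k) x y}. enat k)"

definition dist_sphere :: "'a graph \<Rightarrow> nat \<Rightarrow> 'a \<Rightarrow> 'a set" where
  "dist_sphere G k x = {y \<in> verts G. graph_dist G x y = enat k}"

definition exact_square :: "'a graph \<Rightarrow> 'a \<Rightarrow> 'a \<Rightarrow> 'a \<Rightarrow> bool" where
  "exact_square G x y z \<longleftrightarrow>
     \<not> adj G y z \<and>
     (\<exists>!w. w \<in> dist_sphere G 2 x \<and> adj G w y \<and> adj G w z) \<and>
     (\<forall>w. w \<in> dist_sphere G 2 x \<and> adj G w y \<and> adj G w z \<longrightarrow>
        dist_sphere G 1 x \<inter> dist_sphere G 1 w = {y, z})"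

definition locally_cubical :: "'a graph \<Rightarrow> bool" where
  "locally_cubical G \<longleftrightarrow>
     (\<forall>x\<in>verts G. \<forall>y\<in>dist_sphere G 1 x. \<forall>z\<in>dist_sphere G 1 x.
        y \<noteq> z \<longrightarrow> exact_square G x y z)"

text \<open>\<open>\<bbbF>\<^sub>2\<^sup>r\<close> is modelled by the lists of length \<open>r\<close> over the two-element field \<open>bit\<close>.\<close>

definition hypercube :: "nat \<Rightarrow> bit list graph" where
  "hypercube r =
     \<lparr>verts = {u. length u = r},
      adj = (\<lambda>u v. length u = r \<and> length v = r \<and> card {i. i < r \<and> u ! i \<noteq> v ! i} = 1)\<rparr>"

definition graph_aut :: "'a graph \<Rightarrow> ('a \<Rightarrow> 'a) \<Rightarrow> bool" where
  "graph_aut F \<phi> \<longleftrightarrow>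
     bij_betw \<phi> (verts F) (verts F) \<and>
     (\<forall>u\<in>verts F. \<forall>v\<in>verts F. adj F (\<phi> u) (\<phi> v) \<longleftrightarrow> adj F u v)"

text \<open>
  Only the values \<open>\<sigma> x y u\<close> with \<open>x\<close>, \<open>y\<close> adjacent in \<open>G\<close> and \<open>u\<close> a vertex of \<open>F\<close> are meaningful.
\<close>

definition bundle_map :: "'a graph \<Rightarrow> 'b graph \<Rightarrow> ('a \<Rightarrow> 'a \<Rightarrow> 'b \<Rightarrow> 'b) \<Rightarrow> bool" where
  "bundle_map G F \<sigma> \<longleftrightarrow>
     (\<forall>x y. adj G x y \<longrightarrow>
        graph_aut F (\<sigma> x y) \<and>
        (\<forall>u\<in>verts F. \<sigma> y x u = inv_into (verts F) (\<sigma> x y) u))"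

definition graph_bundle ::
    "'a graph \<Rightarrow> 'b graph \<Rightarrow> ('a \<Rightarrow> 'a \<Rightarrow> 'b \<Rightarrow> 'b) \<Rightarrow> ('a \<times> 'b) graph" where
  "graph_bundle G F \<sigma> =
     \<lparr>verts = verts G \<times> verts F,
      adj = (\<lambda>(x, u) (y, v).
        adj G x y \<and> u \<in> verts F \<and> v = \<sigma> x y u \<or>
        x \<in> verts G \<and> x = y \<and> adj F u v)\<rparr>"

lemma simple_graph_hypercube: "simple_graph (hypercube r)"
proof -
  have "{i. i < r \<and> u ! i \<noteq> v ! i} = {i. i < r \<and> v ! i \<noteq> u ! i}" for u v :: "bit list"
    by metis
  then show ?thesis
    by (simp add: simple_graph_def hypercube_def)
qed

lemma simple_graph_bundle:
  assumes G: "simple_graph G" and F: "simple_graph F" and \<sigma>: "bundle_map G F \<sigma>"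
  shows "simple_graph (graph_bundle G F \<sigma>)"
proof -
  have "\<sigma> x y u \<in> verts F" "\<sigma> y x (\<sigma> x y u) = u" if "adj G x y" "u \<in> verts F" for x y u
  proof -
    have b: "bij_betw (\<sigma> x y) (verts F) (verts F)"
      using \<sigma> that by (simp add: bundle_map_def graph_aut_def)
    then show 1: "\<sigma> x y u \<in> verts F"
      using that by (auto simp: bij_betw_def)
    then show "\<sigma> y x (\<sigma> x y u) = u"
      using b \<sigma> that by (simp add: bundle_map_def bij_betw_def)
  qed
  with G F show ?thesis
    unfolding simple_graph_def graph_bundle_def by (simp add: case_prod_beta) metis
qed

end

theory Submission imports Defs begin

text \<open>
  The statement splits into an equivalence for arbitrary graphs and a study of bundles.

  For a simple graph, being locally cubical means three things (\<open>locally_cubical_iff\<close>): there are no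
  triangles, two distinct vertices have at most two common neighbours, and every path \<open>y, x, z\<close> with
  \<open>y \<noteq> z\<close> is part of a 4-cycle.
  The degrees of a locally cubical graph are constant along edges, because completing \<open>y, x, z\<close> to
  a 4-cycle injects the neighbours \<open>z \<noteq> y\<close> of \<open>x\<close> into the neighbours of \<open>y\<close> other than \<open>x\<close>.

  In a graph whose degrees are constant along edges, let \<open>x\<close> have degree \<open>d\<close> and put
  \<open>a y = f y - f x\<close>.  Completing squares in the definition of \<open>\<Gamma>\<^sub>2\<close> yields (\<open>Gam2_eq\<close>)
  \<open>2 \<Gamma>\<^sub>2(f)(x) = (2 - d) \<Sum>\<^sub>y (a y)\<^sup>2 + (\<Sum>\<^sub>y a y)\<^sup>2 + 1/2 \<Sum>\<^sub>y \<Sum>\<^sub>w (f w - 2 f y + f x)\<^sup>2\<close>,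
  where \<open>y\<close> ranges over the neighbours of \<open>x\<close> and \<open>w\<close> over the neighbours of \<open>y\<close> other than \<open>x\<close>.
  If \<open>w\<close> completes the path \<open>y, x, z\<close>, its two terms in the double sum add up to at least
  \<open>2 (a y - a z)\<^sup>2\<close>.  If all such paths are completed, by vertices \<open>w\<close> that are different for
  different pairs \<open>y, z\<close>, then the last summand is at least the sum of \<open>(a y - a z)\<^sup>2\<close> over unordered
  pairs.  By Lagrange's identity this sum is \<open>d \<Sum>(a y)\<^sup>2 - (\<Sum>a y)\<^sup>2\<close>, and what remains is
  \<open>2 \<Sum>(a y)\<^sup>2 = 4 \<Gamma>(f)(x)\<close>.  Conversely, the values at distance 2 can be chosen freely, and if some path
  \<open>y, x, z\<close> is not completed, a function with \<open>a y = 1\<close> that vanishes at the other neighbours of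
  \<open>x\<close> shows that \<open>CD(2,\<infinity>)\<close> fails.  So under the first two properties and constancy of degrees,
  \<open>CD(2,\<infinity>)\<close> is equivalent to being locally cubical (\<open>CD_iff_locally_cubical\<close>).

  Bundles preserve the absence of triangles, the bound on common neighbours and the constancy of
  degrees along edges, so the equivalence applies to every bundle with locally cubical base and
  fibre.  What a bundle can lose is the completion of paths: two horizontal edges at \<open>(x, u)\<close>
  span a square exactly if the holonomy of \<open>\<sigma>\<close> around the square of the base fixes \<open>u\<close>.  Finally,
  the hypercube is locally cubical.
\<close>

definition nbrs :: "'a graph \<Rightarrow> 'a \<Rightarrow> 'a set" where
  "nbrs G x = {y. adj G x y}"

definition triangle_free :: "'a graph \<Rightarrow> bool" where
  "triangle_free G \<longleftrightarrow> (\<forall>x y z. adj G x y \<longrightarrow> adj G x z \<longrightarrow> \<not> adj G y z)"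

text \<open>
  Equivalently, the complete bipartite graph \<open>K\<^sub>2\<^sub>,\<^sub>3\<close> is not a subgraph.  Stating this for three vertices
  avoids cardinalities, which say nothing about infinite sets of neighbours.
\<close>

definition two_common_nbrs :: "'a graph \<Rightarrow> bool" where
  "two_common_nbrs G \<longleftrightarrow> (\<forall>x w a b c. x \<noteq> w \<longrightarrow>
     {a, b, c} \<subseteq> nbrs G x \<inter> nbrs G w \<longrightarrow> a = b \<or> a = c \<or> b = c)"

text \<open>
  In a triangle-free graph the vertex \<open>w\<close> is at distance 2 from \<open>x\<close>, as in the definition of exact
  square incidence.
\<close>

definition squares_close :: "'a graph \<Rightarrow> bool" where
  "squares_close G \<longleftrightarrow> (\<forall>x y z. adj G x y \<longrightarrow> adj G x z \<longrightarrow> y \<noteq> z \<longrightarrow>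
     (\<exists>w. w \<noteq> x \<and> adj G w y \<and> adj G w z))"

definition locally_regular :: "'a graph \<Rightarrow> bool" where
  "locally_regular G \<longleftrightarrow> (\<forall>x y. adj G x y \<longrightarrow> card (nbrs G x) = card (nbrs G y))"

section \<open>Local structure of locally cubical graphs\<close>

lemma simple_graphD:
  assumes "simple_graph G" "adj G x y"
  shows "x \<in> verts G" "y \<in> verts G" "adj G y x" "x \<noteq> y"
  using assms unfolding simple_graph_def by blast+

lemma two_common_nbrsD:
  assumes "two_common_nbrs G" "x \<noteq> w" "a \<in> nbrs G x \<inter> nbrs G w" "b \<in> nbrs G x \<inter> nbrs G w"
    "c \<in> nbrs G x \<inter> nbrs G w" "a \<noteq> b" "a \<noteq> c"
  shows "b = c"
  using assms unfolding two_common_nbrs_def by (metis empty_subsetI insert_subset)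

lemma graph_dist_le: "(adj G ^^ k) x y \<Longrightarrow> graph_dist G x y \<le> enat k"
  unfolding graph_dist_def by (rule INF_lower) simp

lemma graph_dist_witness:
  assumes "graph_dist G x y = enat k"
  shows "(adj G ^^ k) x y"
proof -
  let ?K = "{k. (adj G ^^ k) x y}"
  have "?K \<noteq> {}"
    using assms unfolding graph_dist_def by (metis (no_types) Inf_enat_def enat.distinct(1) image_empty)
  then have "enat ` ?K \<noteq> {}" by simp
  then have "Inf (enat ` ?K) \<in> enat ` ?K"
    unfolding Inf_enat_def by (auto intro: LeastI)
  then show ?thesis
    using assms unfolding graph_dist_def by auto
qed

lemma graph_dist_eq_iff:
  "graph_dist G x y = enat k \<longleftrightarrow> (adj G ^^ k) x y \<and> (\<forall>j<k. \<not> (adj G ^^ j) x y)"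
proof
  assume k: "graph_dist G x y = enat k"
  then show "(adj G ^^ k) x y \<and> (\<forall>j<k. \<not> (adj G ^^ j) x y)"
    using graph_dist_witness[OF k] graph_dist_le[of _ G x y] by fastforce
next
  assume k: "(adj G ^^ k) x y \<and> (\<forall>j<k. \<not> (adj G ^^ j) x y)"
  obtain j where j: "graph_dist G x y = enat j" "j \<le> k"
    using graph_dist_le[of k G x y] k by (cases "graph_dist G x y") auto
  then show "graph_dist G x y = enat k"
    using graph_dist_witness[OF j(1)] k by (metis le_neq_implies_less)
qed

lemma dist_sphere_1:
  assumes "simple_graph G"
  shows "dist_sphere G 1 x = nbrs G x"
proof -
  have "(adj G ^^ 1) x y \<and> (\<forall>j<1. \<not> (adj G ^^ j) x y) \<longleftrightarrow> adj G x y" for y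
    using simple_graphD(4)[OF assms] by auto
  then show ?thesis
    unfolding dist_sphere_def graph_dist_eq_iff nbrs_def
    using simple_graphD(2)[OF assms] by blast
qed

lemma dist_sphere_2:
  assumes "simple_graph G"
  shows "w \<in> dist_sphere G 2 x \<longleftrightarrow> w \<noteq> x \<and> \<not> adj G x w \<and> (\<exists>y. adj G x y \<and> adj G y w)"
proof -
  have "(adj G ^^ 2) x w \<and> (\<forall>j<2. \<not> (adj G ^^ j) x w) \<longleftrightarrow>
        w \<noteq> x \<and> \<not> adj G x w \<and> (\<exists>y. adj G x y \<and> adj G y w)"
    by (auto simp: numeral_2_eq_2 less_Suc_eq OO_def)
  then show ?thesis
    unfolding dist_sphere_def graph_dist_eq_iff
    using simple_graphD(2)[OF assms] by blast
qed

text \<open>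
  Without triangles, a vertex \<open>w \<noteq> x\<close> that shares a neighbour with \<open>x\<close> is at distance exactly 2.
  The bound on common neighbours then gives the uniqueness of \<open>w\<close>, when it is applied to \<open>y\<close> and \<open>z\<close>
  with common neighbours \<open>x\<close>, \<open>w\<close> and \<open>w'\<close>, and the equation \<open>S\<^sub>1(x) \<inter> S\<^sub>1(w) = {y, z}\<close>, when
  it is applied to \<open>x\<close> and \<open>w\<close>.
\<close>

lemma locally_cubical_iff:
  assumes G: "simple_graph G"
  shows "locally_cubical G \<longleftrightarrow> triangle_free G \<and> two_common_nbrs G \<and> squares_close G"
proof
  assume lc: "locally_cubical G"
  have sq: "exact_square G x y z" if "adj G x y" "adj G x z" "y \<noteq> z" for x y z
    using lc that simple_graphD[OF G] unfolding locally_cubical_def dist_sphere_1[OF G] nbrs_def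
    by blast
  have tf: "triangle_free G"
    unfolding triangle_free_def
    using sq simple_graphD(4)[OF G] unfolding exact_square_def by metis
  have "two_common_nbrs G"
    unfolding two_common_nbrs_def
  proof (intro allI impI, rule ccontr)
    fix x w a b c
    assume xw: "x \<noteq> w" and sub: "{a, b, c} \<subseteq> nbrs G x \<inter> nbrs G w"
      and ne: "\<not> (a = b \<or> a = c \<or> b = c)"
    have adj: "adj G x a" "adj G x b" "adj G w a" "adj G w b" "c \<in> nbrs G x \<inter> nbrs G w"
      using sub by (auto simp: nbrs_def)
    have "w \<in> dist_sphere G 2 x"
      using adj xw tf simple_graphD(3)[OF G] unfolding dist_sphere_2[OF G] triangle_free_def by metis
    then have "nbrs G x \<inter> nbrs G w = {a, b}"
      using sq[of x a b] adj ne unfolding exact_square_def dist_sphere_1[OF G] by metis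
    then show False using adj(5) ne by auto
  qed
  moreover have "squares_close G"
    unfolding squares_close_def
    using sq unfolding exact_square_def dist_sphere_2[OF G] by metis
  ultimately show "triangle_free G \<and> two_common_nbrs G \<and> squares_close G"
    using tf by blast
next
  assume R: "triangle_free G \<and> two_common_nbrs G \<and> squares_close G"
  have com: "a = b \<or> a = c \<or> b = c"
    if "x \<noteq> w" "adj G x a" "adj G x b" "adj G x c" "adj G w a" "adj G w b" "adj G w c" for x w a b c
    using R that two_common_nbrsD[of G x w a b c] unfolding nbrs_def by blast
  have "exact_square G x y z" if a: "adj G x y" "adj G x z" "y \<noteq> z" for x y z
  proof -
    obtain w where w: "w \<noteq> x" "adj G w y" "adj G w z"
      using R a unfolding squares_close_def by blast
    have "w \<in> dist_sphere G 2 x"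
      using R w a simple_graphD(3)[OF G] unfolding dist_sphere_2[OF G] triangle_free_def by metis
    moreover have "w' = w" if "w' \<in> dist_sphere G 2 x" "adj G w' y" "adj G w' z" for w'
      using com[of y z x w w'] that w a simple_graphD(3)[OF G] unfolding dist_sphere_2[OF G] by metis
    moreover have "nbrs G x \<inter> nbrs G w = {y, z}"
      using com[of x w y z] w a unfolding nbrs_def by blast
    ultimately show ?thesis
      using R a w unfolding exact_square_def dist_sphere_1[OF G] triangle_free_def by metis
  qed
  then show "locally_cubical G"
    unfolding locally_cubical_def dist_sphere_1[OF G] nbrs_def by blast
qed

lemma finite_nbrs:
  assumes "simple_graph G" "locally_finite G"
  shows "finite (nbrs G x)"
proof (cases "x \<in> verts G")
  case True
  then show ?thesis using assms unfolding locally_finite_def nbrs_def by blast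
next
  case False
  then have "nbrs G x = {}" using simple_graphD(1)[OF assms(1)] unfolding nbrs_def by blast
  then show ?thesis by simp
qed

text \<open>
  For an edge \<open>x, y\<close>, a vertex that completes \<open>y, x, z\<close> to a 4-cycle determines \<open>z\<close>, because besides
  \<open>y\<close> it has at most one neighbour in common with \<open>x\<close>.  Hence the degree of \<open>x\<close> is at most that of \<open>y\<close>,
  and the edge may be reversed.
\<close>

lemma locally_cubical_imp_locally_regular:
  assumes G: "simple_graph G" "locally_finite G" and lc: "locally_cubical G"
  shows "locally_regular G"
proof -
  have sc: "squares_close G" and tc: "two_common_nbrs G"
    using lc locally_cubical_iff[OF G(1)] by blast+
  have le: "card (nbrs G x) \<le> card (nbrs G y)" if xy: "adj G x y" for x y
  proof -
    have "\<forall>z\<in>nbrs G x - {y}. \<exists>w. w \<noteq> x \<and> adj G w y \<and> adj G w z"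
      using sc xy unfolding squares_close_def nbrs_def by blast
    then obtain q where q: "\<And>z. z \<in> nbrs G x - {y} \<Longrightarrow> q z \<noteq> x \<and> adj G (q z) y \<and> adj G (q z) z"
      by metis
    have "inj_on q (nbrs G x - {y})"
    proof (rule inj_onI)
      fix z z' assume z: "z \<in> nbrs G x - {y}" "z' \<in> nbrs G x - {y}" "q z = q z'"
      have "x \<noteq> q z" "{y, z, z'} \<subseteq> nbrs G x \<inter> nbrs G (q z)"
        using z q[of z] q[of z'] xy by (auto simp: nbrs_def)
      then show "z = z'"
        using z two_common_nbrsD[OF tc, of x "q z" y z z'] by auto
    qed
    moreover have "q ` (nbrs G x - {y}) \<subseteq> nbrs G y - {x}"
      using q simple_graphD(3)[OF G(1)] unfolding nbrs_def by blast
    ultimately have "card (nbrs G x - {y}) \<le> card (nbrs G y - {x})"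
      by (intro card_inj_on_le) (auto simp: finite_nbrs[OF G])
    moreover have "y \<in> nbrs G x" "x \<in> nbrs G y"
      using xy simple_graphD(3)[OF G(1)] by (auto simp: nbrs_def)
    ultimately show ?thesis
      using finite_nbrs[OF G] by (metis Suc_le_mono card_Suc_Diff1)
  qed
  then show ?thesis
    unfolding locally_regular_def using simple_graphD(3)[OF G(1)] by (meson le_antisym)
qed

section \<open>Curvature of locally regular graphs\<close>

lemma laplacian_nbrs: "laplacian G f x = (\<Sum>y\<in>nbrs G x. f y - f x)"
  unfolding laplacian_def nbrs_def by simp

lemma Gam_eq: "Gam G f g x = (\<Sum>y\<in>nbrs G x. (f y - f x) * (g y - g x)) / 2"
proof -
  have "(\<Sum>y\<in>nbrs G x. f y * g y - f x * g x) - f x * (\<Sum>y\<in>nbrs G x. g y - g x)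
      - g x * (\<Sum>y\<in>nbrs G x. f y - f x)
      = (\<Sum>y\<in>nbrs G x. (f y * g y - f x * g x) - f x * (g y - g x) - g x * (f y - f x))"
    by (simp only: sum_distrib_left[symmetric] sum_subtractf)
  also have "\<dots> = (\<Sum>y\<in>nbrs G x. (f y - f x) * (g y - g x))"
    by (rule sum.cong) (auto simp: algebra_simps)
  finally show ?thesis
    unfolding Gam_def laplacian_nbrs by simp
qed

text \<open>
  The values of \<open>f\<close> at a neighbour \<open>w \<noteq> x\<close> of \<open>y\<close> enter through
  \<open>(f w - f y)\<^sup>2 - 2 (f y - f x) (f w - f y)\<close>.  Completing this to the square
  \<open>(f w - 2 f y + f x)\<^sup>2\<close> costs \<open>(f y - f x)\<^sup>2\<close> for each such \<open>w\<close>, that is, \<open>d - 1\<close> times, since \<open>y\<close> has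
  the same degree \<open>d\<close> as \<open>x\<close>.
\<close>

lemma Gam2_eq:
  assumes G: "simple_graph G" "locally_finite G" "locally_regular G"
  shows "2 * Gam2 G f f x =
    (2 - real (card (nbrs G x))) * (\<Sum>y\<in>nbrs G x. (f y - f x)\<^sup>2)
    + (\<Sum>y\<in>nbrs G x. f y - f x)\<^sup>2
    + (\<Sum>y\<in>nbrs G x. \<Sum>w\<in>nbrs G y - {x}. (f w - 2 * f y + f x)\<^sup>2) / 2"
proof -
  define d where "d = real (card (nbrs G x))"
  define a where "a y = f y - f x" for y
  define A where "A = (\<Sum>y\<in>nbrs G x. (a y)\<^sup>2)"
  define S where "S = (\<Sum>y\<in>nbrs G x. a y)"
  define C where "C y = (\<Sum>w\<in>nbrs G y - {x}. (f w - 2 * f y + f x)\<^sup>2)" for y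
  define L where "L = laplacian G f"
  have Gx: "Gam G f f x = A / 2" and Lx: "L x = S"
    unfolding Gam_eq A_def L_def laplacian_nbrs S_def a_def by (simp_all add: power2_eq_square)
  have key: "Gam G f f y - a y * (L y - L x) = (2 - d / 2) * (a y)\<^sup>2 + a y * S + C y / 2"
    if y: "y \<in> nbrs G x" for y
  proof -
    have xy: "x \<in> nbrs G y" and fin: "finite (nbrs G y)"
      using y simple_graphD(3)[OF G(1)] finite_nbrs[OF G(1,2)] by (auto simp: nbrs_def)
    have "card (nbrs G y) = card (nbrs G x)"
      using y G(3) unfolding locally_regular_def nbrs_def by auto
    then have d: "real (card (nbrs G y - {x})) = d - 1"
      unfolding d_def using xy fin by (metis card_Suc_Diff1 of_nat_Suc add_diff_cancel_left')
    define B1 where "B1 = (\<Sum>w\<in>nbrs G y - {x}. f w - f y)"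
    define B2 where "B2 = (\<Sum>w\<in>nbrs G y - {x}. (f w - f y)\<^sup>2)"
    have split: "(\<Sum>w\<in>nbrs G y. h w) = h x + (\<Sum>w\<in>nbrs G y - {x}. h w)" for h :: "'a \<Rightarrow> real"
      using xy fin by (rule sum.remove[rotated])
    have g: "Gam G f f y = ((a y)\<^sup>2 + B2) / 2"
      unfolding Gam_eq split B2_def a_def by (simp add: power2_eq_square algebra_simps)
    have l: "L y = B1 - a y"
      unfolding L_def laplacian_nbrs split B1_def a_def by simp
    have "C y = (\<Sum>w\<in>nbrs G y - {x}. (f w - f y)\<^sup>2 - 2 * a y * (f w - f y) + (a y)\<^sup>2)"
      unfolding C_def a_def by (rule sum.cong) (auto simp: power2_eq_square algebra_simps)
    also have "\<dots> = B2 - 2 * a y * B1 + (d - 1) * (a y)\<^sup>2"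
      unfolding B1_def B2_def sum.distrib sum_subtractf sum_distrib_left[symmetric]
      by (simp add: d)
    finally have c: "C y = B2 - 2 * a y * B1 + (d - 1) * (a y)\<^sup>2" .
    show ?thesis
      unfolding g l c Lx by (simp add: power2_eq_square field_simps)
  qed
  have "2 * Gam2 G f f x = laplacian G (Gam G f f) x - 2 * Gam G f L x"
    unfolding Gam2_def L_def by simp
  also have "\<dots> = (\<Sum>y\<in>nbrs G x. (Gam G f f y - a y * (L y - L x)) - A / 2)"
    unfolding laplacian_nbrs Gam_eq[of G f L] Gx by (simp add: sum_subtractf a_def)
  also have "\<dots> = (\<Sum>y\<in>nbrs G x. (2 - d / 2) * (a y)\<^sup>2 + a y * S + C y / 2 - A / 2)"
    by (rule sum.cong) (auto simp: key)
  also have "\<dots> = (2 - d / 2) * A + S * S + (\<Sum>y\<in>nbrs G x. C y) / 2 - d * (A / 2)"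
    unfolding sum_subtractf sum.distrib sum_distrib_left[symmetric] sum_distrib_right[symmetric]
      sum_divide_distrib[symmetric]
    by (simp add: A_def S_def d_def)
  also have "\<dots> = (2 - d) * A + S\<^sup>2 + (\<Sum>y\<in>nbrs G x. C y) / 2"
    by (simp add: power2_eq_square field_simps)
  finally show ?thesis
    unfolding d_def A_def S_def C_def a_def .
qed

text \<open>
  Lagrange's identity for a sum of squares and the square of a sum.
\<close>

lemma sum_sq_diff:
  fixes a :: "'a \<Rightarrow> real"
  assumes "finite N"
  shows "(\<Sum>y\<in>N. \<Sum>z\<in>N. (a y - a z)\<^sup>2) = 2 * real (card N) * (\<Sum>y\<in>N. (a y)\<^sup>2) - 2 * (\<Sum>y\<in>N. a y)\<^sup>2"
proof -
  have "(\<Sum>y\<in>N. \<Sum>z\<in>N. (a y - a z)\<^sup>2)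
      = (\<Sum>y\<in>N. \<Sum>z\<in>N. (a y)\<^sup>2 + (a z)\<^sup>2 - 2 * (a y * a z))"
    by (intro sum.cong refl) (simp add: power2_eq_square algebra_simps)
  also have "\<dots> = 2 * real (card N) * (\<Sum>y\<in>N. (a y)\<^sup>2) - 2 * (\<Sum>y\<in>N. a y)\<^sup>2"
    by (simp add: sum.distrib sum_subtractf sum_distrib_left[symmetric] sum_distrib_right[symmetric]
        power2_eq_square)
  finally show ?thesis .
qed

text \<open>
  Choose for each pair \<open>y, z\<close> of neighbours of \<open>x\<close> a vertex \<open>q y z\<close> that completes the square.  Dropping
  from the double sum of \<open>Gam2_eq\<close> all \<open>w\<close> other than the chosen ones leaves exactly two terms for each
  unordered pair, and these bound \<open>2 (a y - a z)\<^sup>2\<close> from above whatever the value of \<open>f\<close> at \<open>q y z\<close>.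
\<close>

lemma squares_close_imp_CD:
  assumes G: "simple_graph G" "locally_finite G" "locally_regular G"
    and tc: "two_common_nbrs G" and sc: "squares_close G"
  shows "CD_inf G 2"
  unfolding CD_inf_def
proof (intro allI ballI)
  fix f :: "'a \<Rightarrow> real" and x
  define N where "N = nbrs G x"
  have fin: "finite N" unfolding N_def by (rule finite_nbrs[OF G(1,2)])
  define a where "a y = f y - f x" for y
  define g where "g y w = (f w - 2 * f y + f x)\<^sup>2" for y w
  define q where "q y z = (SOME w. w \<noteq> x \<and> adj G w y \<and> adj G w z)" for y z
  have q: "q y z \<noteq> x \<and> adj G (q y z) y \<and> adj G (q y z) z" if "y \<in> N" "z \<in> N - {y}" for y z
    unfolding q_def
    by (rule someI_ex) (use sc that in \<open>auto simp: squares_close_def N_def nbrs_def\<close>)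
  have q_sym: "q y z = q z y" for y z
    unfolding q_def by (rule arg_cong[of _ _ Eps]) blast
  have inj: "inj_on (q y) (N - {y})" if y: "y \<in> N" for y
  proof (rule inj_onI)
    fix z z' assume z: "z \<in> N - {y}" "z' \<in> N - {y}" "q y z = q y z'"
    have "x \<noteq> q y z" "{y, z, z'} \<subseteq> nbrs G x \<inter> nbrs G (q y z)"
      using z q[OF y z(1)] q[OF y z(2)] y by (auto simp: N_def nbrs_def)
    then show "z = z'"
      using z two_common_nbrsD[OF tc, of x "q y z" y z z'] by auto
  qed
  have diag: "(\<Sum>y\<in>N. \<Sum>z\<in>N - {y}. h y z) = (\<Sum>y\<in>N. \<Sum>z\<in>N. if z = y then 0 else h y z)"
    for h :: "'a \<Rightarrow> 'a \<Rightarrow> real"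
  proof (rule sum.cong[OF refl])
    fix y assume "y \<in> N"
    then show "(\<Sum>z\<in>N - {y}. h y z) = (\<Sum>z\<in>N. if z = y then 0 else h y z)"
      using fin by (intro sum.mono_neutral_cong_left) auto
  qed
  \<comment> \<open>The chosen vertex is symmetric in \<open>y\<close> and \<open>z\<close>, so
    exchanging the summation variables shows that both members of a pair contribute equally.\<close>
  have swap: "(\<Sum>y\<in>N. \<Sum>z\<in>N - {y}. g z (q y z)) = (\<Sum>y\<in>N. \<Sum>z\<in>N - {y}. g y (q y z))"
    unfolding diag by (subst sum.swap) (intro sum.cong refl, auto simp: q_sym)
  have "2 * real (card N) * (\<Sum>y\<in>N. (a y)\<^sup>2) - 2 * (\<Sum>y\<in>N. a y)\<^sup>2
      = (\<Sum>y\<in>N. \<Sum>z\<in>N - {y}. (a y - a z)\<^sup>2)"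
    unfolding sum_sq_diff[OF fin, symmetric] diag by (intro sum.cong refl) auto
  also have "\<dots> \<le> (\<Sum>y\<in>N. \<Sum>z\<in>N - {y}. (g y (q y z) + g z (q y z)) / 2)"
  proof (intro sum_mono)
    fix y z
    \<comment> \<open>The difference of the two sides is \<open>2 (v - s - t)\<^sup>2\<close>.\<close>
    have "2 * (s - t)\<^sup>2 \<le> (v - 2 * s)\<^sup>2 + (v - 2 * t)\<^sup>2" for s t v :: real
      using zero_le_power2[of "v - s - t"] by (simp add: power2_eq_square algebra_simps)
    from this[of "a y" "a z" "f (q y z) - f x"]
    show "(a y - a z)\<^sup>2 \<le> (g y (q y z) + g z (q y z)) / 2"
      unfolding g_def a_def by (simp add: algebra_simps)
  qed
  also have "\<dots> = (\<Sum>y\<in>N. \<Sum>z\<in>N - {y}. g y (q y z))"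
    using swap by (simp add: sum.distrib sum_divide_distrib[symmetric])
  also have "\<dots> \<le> (\<Sum>y\<in>N. \<Sum>w\<in>nbrs G y - {x}. g y w)"
  proof (rule sum_mono)
    fix y assume y: "y \<in> N"
    have "(\<Sum>z\<in>N - {y}. g y (q y z)) = (\<Sum>w\<in>q y ` (N - {y}). g y w)"
      using inj[OF y] by (simp add: sum.reindex)
    also have "\<dots> \<le> (\<Sum>w\<in>nbrs G y - {x}. g y w)"
    proof (rule sum_mono2)
      show "finite (nbrs G y - {x})" using finite_nbrs[OF G(1,2)] by simp
      show "q y ` (N - {y}) \<subseteq> nbrs G y - {x}"
        using q[OF y] simple_graphD(3)[OF G(1)] unfolding nbrs_def by blast
    qed (simp add: g_def)
    finally show "(\<Sum>z\<in>N - {y}. g y (q y z)) \<le> (\<Sum>w\<in>nbrs G y - {x}. g y w)" .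
  qed
  finally have "2 * (\<Sum>y\<in>N. (a y)\<^sup>2) \<le> 2 * Gam2 G f f x"
    unfolding Gam2_eq[OF G] N_def[symmetric] g_def[symmetric] a_def[symmetric]
    by (simp add: algebra_simps)
  then show "2 * Gam G f f x \<le> Gam2 G f f x"
    unfolding Gam_eq N_def a_def by (simp add: power2_eq_square)
qed

text \<open>
  If \<open>y, x, z\<close> is not part of a 4-cycle, take \<open>f\<close> to be 1 at \<open>y\<close> and 0 at \<open>x\<close> and at its other
  neighbours, and at distance 2 choose the values that minimise the double sum of \<open>Gam2_eq\<close>: at a
  neighbour \<open>w\<close> of \<open>y\<close>, the value 1 if \<open>w\<close> has a second neighbour in common with \<open>x\<close>, and 2
  otherwise.  Then each 4-cycle through \<open>y, x\<close> contributes 2 to the double sum.  Such a cycle is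
  determined by its other neighbour of \<open>x\<close>, which is neither \<open>y\<close> nor \<open>z\<close>, so there are at most
  \<open>d - 2\<close> of them, and \<open>2 \<Gamma>\<^sub>2(f)(x) \<le> (2 - d) + 1 + (d - 2) = 1\<close>.  But \<open>4 \<Gamma>(f)(x) = 2\<close>.
\<close>

lemma CD_imp_squares_close:
  assumes G: "simple_graph G" "locally_finite G" "locally_regular G"
    and tf: "triangle_free G" and tc: "two_common_nbrs G" and cd: "CD_inf G 2"
  shows "squares_close G"
proof (rule ccontr)
  assume "\<not> squares_close G"
  then obtain x y z where xy: "adj G x y" and xz: "adj G x z" and yz: "y \<noteq> z"
    and bad: "\<And>w. w \<noteq> x \<Longrightarrow> adj G w y \<Longrightarrow> \<not> adj G w z"
    unfolding squares_close_def by blast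
  note sym = simple_graphD(3)[OF G(1)] and irr = simple_graphD(4)[OF G(1)]
  define N where "N = nbrs G x"
  have fin: "finite N" and yN: "y \<in> N" and zN: "z \<in> N"
    unfolding N_def using finite_nbrs[OF G(1,2)] xy xz by (auto simp: nbrs_def)
  define c where "c v = nbrs G y \<inter> nbrs G v - {x}" for v
  define W where "W = (\<Union>v\<in>N - {y}. c v)"
  define f :: "'a \<Rightarrow> real" where
    "f v = (if v = y then 1 else if v = x \<or> \<not> adj G y v then 0 else if v \<in> W then 1 else 2)" for v
  have fx: "f x = 0" and fy: "f y = 1" using xy irr unfolding f_def by auto
  have nadj: "\<not> adj G y v" "\<not> adj G v y" if "v \<in> N" for v
    using that tf xy unfolding N_def nbrs_def triangle_free_def by blast+
  have fN: "f v = 0" if "v \<in> N - {y}" for v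
    using that nadj(1) unfolding f_def by simp
  have finc: "finite (c v)" for v
    unfolding c_def using finite_nbrs[OF G(1,2)] by simp
  have split: "(\<Sum>v\<in>N. h v) = h y + (\<Sum>v\<in>N - {y}. h v)" for h :: "'a \<Rightarrow> real"
    using fin yN by (rule sum.remove)
  have A: "(\<Sum>v\<in>N. (f v - f x)\<^sup>2) = 1" and S: "(\<Sum>v\<in>N. f v - f x) = 1"
    unfolding split fx fy by (simp_all add: fN)
  have Cy: "(\<Sum>w\<in>nbrs G y - {x}. (f w - 2 * f y + f x)\<^sup>2) = real (card W)"
  proof -
    have "W \<subseteq> nbrs G y - {x}" unfolding W_def c_def by blast
    moreover have "(f w - 2 * f y + f x)\<^sup>2 = (if w \<in> W then 1 else 0)" if "w \<in> nbrs G y - {x}" for w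
    proof -
      have "f w = (if w \<in> W then 1 else 2)"
        using that irr[of y w] unfolding f_def nbrs_def by simp
      then show ?thesis unfolding fx fy by simp
    qed
    ultimately show ?thesis
      using finite_nbrs[OF G(1,2), of y] by (simp add: sum.If_cases Int_absorb1)
  qed
  have Cv: "(\<Sum>w\<in>nbrs G v - {x}. (f w - 2 * f v + f x)\<^sup>2) = real (card (c v))" if v: "v \<in> N - {y}" for v
  proof -
    have "(f w - 2 * f v + f x)\<^sup>2 = (if w \<in> c v then 1 else 0)" if w: "w \<in> nbrs G v - {x}" for w
    proof -
      have "w \<noteq> y" "w \<in> c v \<longleftrightarrow> adj G y w" "w \<in> c v \<Longrightarrow> w \<in> W"
        using w v nadj(2)[of v] unfolding nbrs_def c_def W_def by blast+
      then have "f w = (if w \<in> c v then 1 else 0)"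
        using w unfolding f_def by simp
      then show ?thesis unfolding fx fN[OF v] by simp
    qed
    moreover have "c v \<subseteq> nbrs G v - {x}" unfolding c_def by blast
    ultimately show ?thesis
      using finite_nbrs[OF G(1,2), of v] by (simp add: sum.If_cases Int_absorb1)
  qed
  \<comment> \<open>Two elements of \<open>c v\<close> would, together with \<open>x\<close>, be three common neighbours of \<open>y\<close> and \<open>v\<close>.\<close>
  have c1: "card (c v) \<le> (if v = z then 0 else 1)" if v: "v \<in> N - {y}" for v
  proof (cases "v = z")
    case True
    then have "c v = {}" using bad sym unfolding c_def nbrs_def by blast
    then show ?thesis by simp
  next
    case False
    have "p = p'" if "p \<in> c v" "p' \<in> c v" for p p'
    proof -
      have "x \<in> nbrs G y \<inter> nbrs G v"
        using v xy sym unfolding nbrs_def N_def by auto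
      then show ?thesis
        using two_common_nbrsD[OF tc, of y v x p p'] v that unfolding c_def by auto
    qed
    then show ?thesis
      using False by (simp add: card_le_Suc0_iff_eq[OF finc])
  qed
  have "(\<Sum>v\<in>N - {y}. card (c v)) \<le> (\<Sum>v\<in>N - {y}. if v = z then 0 else 1)"
    by (rule sum_mono) (rule c1)
  also have "\<dots> = card (N - {y} - {z})"
    using fin by (simp add: sum.If_cases Diff_eq)
  finally have sc: "(\<Sum>v\<in>N - {y}. card (c v)) \<le> card (N - {y} - {z})" .
  have cN: "card N = Suc (Suc (card (N - {y} - {z})))"
    using fin yN zN yz by (metis card_Suc_Diff1 finite_Diff insertE insert_Diff)
  have "card W \<le> (\<Sum>v\<in>N - {y}. card (c v))"
    unfolding W_def by (rule card_UN_le) (use fin in simp)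
  then have tot: "card W + (\<Sum>v\<in>N - {y}. card (c v)) + 4 \<le> 2 * card N"
    using sc cN by linarith
  have "(\<Sum>v\<in>N. \<Sum>w\<in>nbrs G v - {x}. (f w - 2 * f v + f x)\<^sup>2)
      = real (card W + (\<Sum>v\<in>N - {y}. card (c v)))"
    unfolding split Cy by (simp add: Cv)
  then have "2 * Gam2 G f f x = (2 - real (card N)) + 1 + real (card W + (\<Sum>v\<in>N - {y}. card (c v))) / 2"
    unfolding Gam2_eq[OF G] N_def[symmetric] A S by simp
  moreover have "real (card W + (\<Sum>v\<in>N - {y}. card (c v))) + 4 \<le> 2 * real (card N)"
    using tot by linarith
  ultimately have "2 * Gam2 G f f x \<le> 1" by argo
  moreover have "2 * Gam G f f x \<le> Gam2 G f f x"
    using cd simple_graphD(1)[OF G(1) xy] unfolding CD_inf_def by blast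
  moreover have "2 * Gam G f f x = 1"
    using A unfolding Gam_eq N_def by (simp add: power2_eq_square)
  ultimately show False by linarith
qed

theorem CD_iff_locally_cubical:
  assumes "simple_graph G" "locally_finite G" "locally_regular G"
    and "triangle_free G" "two_common_nbrs G"
  shows "CD_inf G 2 \<longleftrightarrow> locally_cubical G"
  using squares_close_imp_CD[OF assms(1-3,5)] CD_imp_squares_close[OF assms] assms(4,5)
    locally_cubical_iff[OF assms(1)] by blast

section \<open>Bundles of locally cubical graphs\<close>

context
  fixes G :: "'a graph" and F :: "'b graph" and \<sigma> :: "'a \<Rightarrow> 'a \<Rightarrow> 'b \<Rightarrow> 'b"
  assumes G: "simple_graph G" and F: "simple_graph F" and \<sigma>: "bundle_map G F \<sigma>"
begin

lemma bundle_map_inverse: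
  assumes "adj G x y" "u \<in> verts F"
  shows "\<sigma> x y u \<in> verts F" "\<sigma> y x (\<sigma> x y u) = u"
proof -
  have b: "bij_betw (\<sigma> x y) (verts F) (verts F)"
    using \<sigma> assms by (simp add: bundle_map_def graph_aut_def)
  then show 1: "\<sigma> x y u \<in> verts F"
    using assms by (auto simp: bij_betw_def)
  then show "\<sigma> y x (\<sigma> x y u) = u"
    using b \<sigma> assms by (simp add: bundle_map_def bij_betw_def)
qed

lemma bundle_adj:
  "adj (graph_bundle G F \<sigma>) (x, u) (y, v) \<longleftrightarrow>
     adj G x y \<and> u \<in> verts F \<and> v = \<sigma> x y u \<or> x \<in> verts G \<and> x = y \<and> adj F u v"
  by (simp add: graph_bundle_def)

text \<open>
  A triangle with a horizontal edge projects to a closed walk of length at most 3 in the base with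
  at least one step.  As the base has no triangles, it goes back and forth along one edge, and
  since \<open>\<sigma> y x\<close> inverts \<open>\<sigma> x y\<close>, the third edge would be a loop.
\<close>

lemma triangle_free_bundle:
  assumes "triangle_free G" "triangle_free F"
  shows "triangle_free (graph_bundle G F \<sigma>)"
  unfolding triangle_free_def
proof (intro allI impI notI)
  fix p q s
  assume a: "adj (graph_bundle G F \<sigma>) p q" "adj (graph_bundle G F \<sigma>) p s"
    "adj (graph_bundle G F \<sigma>) q s"
  obtain x u y v z w where p: "p = (x, u)" "q = (y, v)" "s = (z, w)" by (cases p, cases q, cases s)
  have irr: "\<not> adj G x x" "\<not> adj F u u" for x u
    using simple_graphD(4)[OF G] simple_graphD(4)[OF F] by blast+
  show False
    using a assms irr bundle_map_inverse simple_graphD(3)[OF G] simple_graphD(3)[OF F]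
    unfolding p bundle_adj triangle_free_def by metis
qed

text \<open>
  Consider common neighbours of \<open>(x, u)\<close> and \<open>(y, v)\<close>.  If \<open>x = y\<close>, they lie in the same fibre, as
  \<open>\<sigma> x z\<close> is injective.  If \<open>x\<close> and \<open>y\<close> are adjacent, one of the two edges is vertical, because the
  base has no triangles, and there is at most one common neighbour for either order.  Otherwise both edges
  are horizontal, and the common neighbour is determined by its projection to the base.
\<close>

lemma two_common_nbrs_bundle:
  assumes tf: "triangle_free G" and "two_common_nbrs G" "two_common_nbrs F"
  shows "two_common_nbrs (graph_bundle G F \<sigma>)"
  unfolding two_common_nbrs_def
proof (intro allI impI)
  fix p q s1 s2 s3
  assume pq: "p \<noteq> q"
    and sub: "{s1, s2, s3} \<subseteq> nbrs (graph_bundle G F \<sigma>) p \<inter> nbrs (graph_bundle G F \<sigma>) q"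
  obtain x u y v where p: "p = (x, u)" "q = (y, v)" by (cases p, cases q)
  note sym = simple_graphD(3)[OF G] and irr = simple_graphD(4)[OF G]
  show "s1 = s2 \<or> s1 = s3 \<or> s2 = s3"
  proof (cases "x = y")
    case True
    have "\<exists>e. s = (x, e) \<and> adj F u e \<and> adj F v e" if "s \<in> {s1, s2, s3}" for s
    proof -
      obtain z e where s: "s = (z, e)" by (cases s)
      have "adj (graph_bundle G F \<sigma>) (x, u) (z, e)" "adj (graph_bundle G F \<sigma>) (x, v) (z, e)"
        using that sub True unfolding nbrs_def p s by auto
      then show ?thesis
        using pq True irr bundle_map_inverse(2) unfolding bundle_adj p s by (metis Pair_inject)
    qed
    then obtain e1 e2 e3 where e: "s1 = (x, e1)" "s2 = (x, e2)" "s3 = (x, e3)"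
      "{e1, e2, e3} \<subseteq> nbrs F u \<inter> nbrs F v"
      unfolding nbrs_def by (metis (lifting) Int_Collect empty_subsetI insertCI insert_subset mem_Collect_eq)
    then have "e1 = e2 \<or> e1 = e3 \<or> e2 = e3"
      using two_common_nbrsD[OF assms(3), of u v e1 e2 e3] pq p True by auto
    then show ?thesis using e by blast
  next
    case False
    have s: "adj (graph_bundle G F \<sigma>) (x, u) s" "adj (graph_bundle G F \<sigma>) (y, v) s"
      if "s \<in> {s1, s2, s3}" for s
      using that sub unfolding nbrs_def p by auto
    show ?thesis
    proof (cases "adj G x y")
      case xy: True
      have "s = (x, \<sigma> y x v) \<or> s = (y, \<sigma> x y u)" if "s \<in> {s1, s2, s3}" for s
      proof -
        obtain z e where z: "s = (z, e)" by (cases s)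
        show ?thesis
          using s[OF that] False xy tf sym unfolding z bundle_adj triangle_free_def by metis
      qed
      then show ?thesis by (metis insertCI)
    next
      case nxy: False
      have "\<exists>z. s = (z, \<sigma> x z u) \<and> adj G x z \<and> adj G y z" if "s \<in> {s1, s2, s3}" for s
      proof -
        obtain z e where z: "s = (z, e)" by (cases s)
        show ?thesis
          using s[OF that] False nxy sym unfolding z bundle_adj by metis
      qed
      then obtain z1 z2 z3 where z: "s1 = (z1, \<sigma> x z1 u)" "s2 = (z2, \<sigma> x z2 u)"
        "s3 = (z3, \<sigma> x z3 u)" "{z1, z2, z3} \<subseteq> nbrs G x \<inter> nbrs G y"
        unfolding nbrs_def by (metis (lifting) Int_Collect empty_subsetI insertCI insert_subset mem_Collect_eq)
      then have "z1 = z2 \<or> z1 = z3 \<or> z2 = z3"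
        using two_common_nbrsD[OF assms(2), of x y z1 z2 z3] False by auto
      then show ?thesis using z by blast
    qed
  qed
qed

lemma nbrs_bundle:
  assumes "x \<in> verts G" "u \<in> verts F"
  shows "nbrs (graph_bundle G F \<sigma>) (x, u) = (\<lambda>y. (y, \<sigma> x y u)) ` nbrs G x \<union> Pair x ` nbrs F u"
  using assms unfolding nbrs_def by (auto simp: bundle_adj)

lemma locally_finite_bundle:
  assumes "locally_finite G" "locally_finite F"
  shows "locally_finite (graph_bundle G F \<sigma>)"
  unfolding locally_finite_def nbrs_def[symmetric]
proof
  fix p assume "p \<in> verts (graph_bundle G F \<sigma>)"
  then obtain x u where "p = (x, u)" "x \<in> verts G" "u \<in> verts F"
    by (cases p) (auto simp: graph_bundle_def)
  then show "finite (nbrs (graph_bundle G F \<sigma>) p)"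
    using nbrs_bundle finite_nbrs[OF G assms(1)] finite_nbrs[OF F assms(2)] by simp
qed

lemma card_nbrs_bundle:
  assumes "locally_finite G" "locally_finite F" "x \<in> verts G" "u \<in> verts F"
  shows "card (nbrs (graph_bundle G F \<sigma>) (x, u)) = card (nbrs G x) + card (nbrs F u)"
proof -
  have "(\<lambda>y. (y, \<sigma> x y u)) ` nbrs G x \<inter> Pair x ` nbrs F u = {}"
    using simple_graphD(4)[OF G] unfolding nbrs_def by auto
  then show ?thesis
    unfolding nbrs_bundle[OF assms(3,4)]
    using finite_nbrs[OF G assms(1)] finite_nbrs[OF F assms(2)]
    by (simp add: card_Un_disjoint card_image inj_on_def)
qed

lemma card_nbrs_bundle_map:
  assumes "adj G x y" "u \<in> verts F"
  shows "card (nbrs F (\<sigma> x y u)) = card (nbrs F u)"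
proof -
  have aut: "adj F (\<sigma> a b c) (\<sigma> a b d) \<longleftrightarrow> adj F c d"
    if "adj G a b" "c \<in> verts F" "d \<in> verts F" for a b c d
    using \<sigma> that unfolding bundle_map_def graph_aut_def by blast
  have "bij_betw (\<sigma> x y) (nbrs F u) (nbrs F (\<sigma> x y u))"
  proof (rule bij_betw_byWitness[where f' = "\<sigma> y x"])
    have v: "nbrs F w \<subseteq> verts F" for w
      using simple_graphD(2)[OF F] unfolding nbrs_def by blast
    have yx: "adj G y x" using assms simple_graphD(3)[OF G] by blast
    show "\<forall>a\<in>nbrs F u. \<sigma> y x (\<sigma> x y a) = a"
      using v bundle_map_inverse(2)[OF assms(1)] by blast
    show "\<forall>a\<in>nbrs F (\<sigma> x y u). \<sigma> x y (\<sigma> y x a) = a"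
      using v bundle_map_inverse(2)[OF yx] by blast
    show "\<sigma> x y ` nbrs F u \<subseteq> nbrs F (\<sigma> x y u)"
      using aut[OF assms(1,2)] v[of u] unfolding nbrs_def by blast
    show "\<sigma> y x ` nbrs F (\<sigma> x y u) \<subseteq> nbrs F u"
      using aut[OF yx bundle_map_inverse(1)[OF assms]] bundle_map_inverse(2)[OF assms]
        v[of "\<sigma> x y u"] unfolding nbrs_def by auto
  qed
  then show ?thesis using bij_betw_same_card by metis
qed

lemma locally_regular_bundle:
  assumes fin: "locally_finite G" "locally_finite F" and "locally_regular G" "locally_regular F"
  shows "locally_regular (graph_bundle G F \<sigma>)"
  unfolding locally_regular_def
proof (intro allI impI)
  fix p q assume a: "adj (graph_bundle G F \<sigma>) p q"
  obtain x u y v where p: "p = (x, u)" "q = (y, v)" by (cases p, cases q)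
  consider (h) "adj G x y" "u \<in> verts F" "v = \<sigma> x y u" | (v) "x \<in> verts G" "x = y" "adj F u v"
    using a unfolding p bundle_adj by blast
  then show "card (nbrs (graph_bundle G F \<sigma>) p) = card (nbrs (graph_bundle G F \<sigma>) q)"
  proof cases
    case h
    then show ?thesis
      using assms(3) card_nbrs_bundle[OF fin] card_nbrs_bundle_map bundle_map_inverse(1)
        simple_graphD(1,2)[OF G]
      unfolding p locally_regular_def by metis
  next
    case v
    then show ?thesis
      using assms(4) card_nbrs_bundle[OF fin] simple_graphD(1,2)[OF F]
      unfolding p locally_regular_def by metis
  qed
qed

text \<open>
  The degree of \<open>(x, u)\<close> is the sum of the degrees of \<open>x\<close> and \<open>u\<close>, and \<open>\<sigma> x y\<close> preserves degrees in the
  fibre.  Hence all that the general equivalence needs passes from base and fibre to the bundle.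
\<close>

theorem CD_bundle_iff_locally_cubical:
  assumes fin: "locally_finite G" "locally_finite F" and lc: "locally_cubical G" "locally_cubical F"
  shows "CD_inf (graph_bundle G F \<sigma>) 2 \<longleftrightarrow> locally_cubical (graph_bundle G F \<sigma>)"
proof (rule CD_iff_locally_cubical)
  note cub = lc[unfolded locally_cubical_iff[OF G] locally_cubical_iff[OF F]]
  show "simple_graph (graph_bundle G F \<sigma>)" by (rule simple_graph_bundle[OF G F \<sigma>])
  show "locally_finite (graph_bundle G F \<sigma>)" by (rule locally_finite_bundle[OF fin])
  show "locally_regular (graph_bundle G F \<sigma>)"
    using locally_regular_bundle[OF fin] locally_cubical_imp_locally_regular[OF G fin(1) lc(1)]
      locally_cubical_imp_locally_regular[OF F fin(2) lc(2)] by blast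
  show "triangle_free (graph_bundle G F \<sigma>)" using triangle_free_bundle cub by blast
  show "two_common_nbrs (graph_bundle G F \<sigma>)" using two_common_nbrs_bundle cub by blast
qed

end

section \<open>The hypercube\<close>

definition diff_set :: "bit list \<Rightarrow> bit list \<Rightarrow> nat set" where
  "diff_set u v = {i. i < length u \<and> u ! i \<noteq> v ! i}"

lemma hypercube_adj:
  "adj (hypercube r) u v \<longleftrightarrow> length u = r \<and> length v = r \<and> (\<exists>i. diff_set u v = {i})"
proof -
  have "length u = r \<Longrightarrow> {i. i < r \<and> u ! i \<noteq> v ! i} = diff_set u v"
    by (auto simp: diff_set_def)
  then show ?thesis
    by (auto simp: hypercube_def card_1_singleton_iff)
qed

text \<open>
  With two letters only, sets of differing coordinates add up by symmetric difference.  This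
  reduces the geometry of the hypercube to sets of at most two coordinates.
\<close>

lemma diff_set_trans:
  assumes "length u = length v"
  shows "i \<in> diff_set u w \<longleftrightarrow> (i \<in> diff_set u v) \<noteq> (i \<in> diff_set v w)"
proof -
  have "(a \<noteq> c) = ((a \<noteq> b) \<noteq> (b \<noteq> c))" for a b c :: bit
    by (cases a; cases b; cases c) auto
  then show ?thesis using assms unfolding diff_set_def by auto
qed

lemma diff_set_empty_iff:
  assumes "length u = length v"
  shows "diff_set u v = {} \<longleftrightarrow> u = v"
  using assms unfolding diff_set_def by (auto intro: nth_equalityI)

lemma locally_finite_hypercube: "locally_finite (hypercube r)"
proof -
  have "(UNIV :: bit set) \<subseteq> {0, 1}" by (auto simp: bit_not_zero_iff)
  then have "finite (UNIV :: bit set)" using finite_subset by blast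
  then have "finite {u :: bit list. length u = r}"
    using finite_lists_length_eq[of "UNIV :: bit set" r] by simp
  moreover have "{y. adj (hypercube r) x y} \<subseteq> {u. length u = r}" for x
    by (auto simp: hypercube_def)
  ultimately show ?thesis
    unfolding locally_finite_def using finite_subset by blast
qed

text \<open>
  A triangle would make a symmetric difference of two singletons a singleton.  If \<open>x\<close> and \<open>w\<close> are
  distinct with a common neighbour, they differ in two coordinates, and a common neighbour arises
  from \<open>x\<close> by changing one of these.  The square on \<open>x, y, z\<close> is closed by changing both coordinates.
\<close>

lemma locally_cubical_hypercube: "locally_cubical (hypercube r)"
  unfolding locally_cubical_iff[OF simple_graph_hypercube]
proof (intro conjI)
  show "triangle_free (hypercube r)"
    unfolding triangle_free_def
  proof (intro allI impI notI)
    fix x y z assume a: "adj (hypercube r) x y" "adj (hypercube r) x z" "adj (hypercube r) y z"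
    then obtain i j k where D: "diff_set x y = {i}" "diff_set x z = {j}" "diff_set y z = {k}"
      and l: "length x = length y"
      unfolding hypercube_adj by auto
    show False
      using diff_set_trans[OF l, of _ z] unfolding D by (metis singletonD singletonI)
  qed
next
  show "two_common_nbrs (hypercube r)"
    unfolding two_common_nbrs_def
  proof (intro allI impI)
    fix x w a b c
    assume xw: "x \<noteq> w" and sub: "{a, b, c} \<subseteq> nbrs (hypercube r) x \<inter> nbrs (hypercube r) w"
    have adj: "adj (hypercube r) x s" "adj (hypercube r) s w" if "s \<in> {a, b, c}" for s
      using sub that simple_graphD(3)[OF simple_graph_hypercube] unfolding nbrs_def by blast+
    define i where "i s = (THE i. diff_set x s = {i})" for s
    have len: "length s = r" "length x = r" "length w = r" if "s \<in> {a, b, c}" for s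
      using adj[OF that] unfolding hypercube_adj by blast+
    have i: "diff_set x s = {i s}" if "s \<in> {a, b, c}" for s
      using adj(1)[OF that] unfolding hypercube_adj i_def by auto
    have eq: "s = t" if "s \<in> {a, b, c}" "t \<in> {a, b, c}" "i s = i t" for s t
    proof -
      have l: "length x = length s" "length s = length t"
        using len(1)[OF that(1)] len(1)[OF that(2)] len(2)[OF that(1)] by simp_all
      have "diff_set x t = diff_set x s"
        unfolding i[OF that(1)] i[OF that(2)] that(3) ..
      then have "diff_set s t = {}"
        using diff_set_trans[OF l(1), of _ t] by blast
      then show ?thesis using diff_set_empty_iff[OF l(2)] by simp
    qed
    have "\<exists>k. diff_set x w = {i s, k} \<and> k \<noteq> i s" if s: "s \<in> {a, b, c}" for s
    proof -
      obtain k where k: "diff_set s w = {k}" using adj(2)[OF s] unfolding hypercube_adj by blast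
      have t: "j \<in> diff_set x w \<longleftrightarrow> (j = i s) \<noteq> (j = k)" for j
        using diff_set_trans[of x s j w] i[OF s] k len[OF s] by simp
      have "diff_set x w \<noteq> {}" using diff_set_empty_iff[of x w] xw len(2,3)[OF s] by simp
      then have "k \<noteq> i s" using t by blast
      then show ?thesis using t by blast
    qed
    then obtain k where "\<And>s. s \<in> {a, b, c} \<Longrightarrow> diff_set x w = {i s, k s} \<and> k s \<noteq> i s"
      by metis
    then have "{i a, k a} = {i b, k b}" "{i a, k a} = {i c, k c}" "k a \<noteq> i a"
      by (metis insertI1 insertI2)+
    then have "i a = i b \<or> i a = i c \<or> i b = i c"
      unfolding doubleton_eq_iff by metis
    then show "a = b \<or> a = c \<or> b = c" using eq by blast
  qed
next
  show "squares_close (hypercube r)"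
    unfolding squares_close_def
  proof (intro allI impI)
    fix x y z assume a: "adj (hypercube r) x y" "adj (hypercube r) x z" "y \<noteq> z"
    then obtain i j where D: "diff_set x y = {i}" "diff_set x z = {j}"
      and l: "length x = r" "length y = r" "length z = r"
      unfolding hypercube_adj by auto
    have ij: "i \<noteq> j"
    proof
      assume "i = j"
      then have "diff_set y z = {}"
        using diff_set_trans[of x y _ z] D l by auto
      then show False using diff_set_empty_iff[of y z] l a(3) by simp
    qed
    have i: "i < r" "x ! i \<noteq> y ! i" and j: "j < r" "x ! j \<noteq> z ! j"
      using D l unfolding diff_set_def by auto
    have y: "y ! n = x ! n" if "n < r" "n \<noteq> i" for n
    proof -
      have "n \<notin> diff_set x y" using that D(1) by simp
      then show ?thesis using that l unfolding diff_set_def by simp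
    qed
    have z: "z ! n = x ! n" if "n < r" "n \<noteq> j" for n
    proof -
      have "n \<notin> diff_set x z" using that D(2) by simp
      then show ?thesis using that l unfolding diff_set_def by simp
    qed
    define w where "w = y[j := z ! j]"
    have lw: "length w = r" using l by (simp add: w_def)
    have wj: "w ! j = z ! j" using j(1) l by (simp add: w_def)
    have w: "w ! n = y ! n" if "n \<noteq> j" for n using that by (simp add: w_def)
    have "n \<in> diff_set w y \<longleftrightarrow> n = j" for n
      using w[of n] wj j y[OF j(1)] ij lw unfolding diff_set_def by (cases "n = j") simp_all
    moreover have "n \<in> diff_set w z \<longleftrightarrow> n = i" for n
    proof (cases "n = j")
      case True
      then show ?thesis using wj ij unfolding diff_set_def by simp
    next
      case False
      then show ?thesis
        using w[of n] y[of n] z[of n] i lw ij unfolding diff_set_def by (cases "n = i") auto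
    qed
    ultimately have "diff_set w y = {j}" "diff_set w z = {i}" by blast+
    moreover have "w \<noteq> x" using wj j(2) by metis
    ultimately show "\<exists>w. w \<noteq> x \<and> adj (hypercube r) w y \<and> adj (hypercube r) w z"
      unfolding hypercube_adj using l lw by blast
  qed
qed

section \<open>Hypercube bundles\<close>

theorem theorem6p15:
  fixes G' :: "'a graph" and r :: nat and \<sigma> :: "'a \<Rightarrow> 'a \<Rightarrow> bit list \<Rightarrow> bit list"
  assumes "simple_graph G'" and "locally_finite G'" and "connected_graph G'"
    and "locally_cubical G'"
    and "r \<ge> 1"
    and "bundle_map G' (hypercube r) \<sigma>"
  shows "CD_inf (graph_bundle G' (hypercube r) \<sigma>) 2 \<longleftrightarrow>
         locally_cubical (graph_bundle G' (hypercube r) \<sigma>)"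
  using CD_bundle_iff_locally_cubical[OF assms(1) simple_graph_hypercube assms(6) assms(2)
      locally_finite_hypercube assms(4) locally_cubical_hypercube] .

end
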